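(* There is an isometry $g$ of $\mathbb{Q}\mathbb{U}$ such that the cyclic group $\langle g\rangle$ is transitive on $\mathbb{Q}\mathbb{U}$.
   Context: $\mathbb{Q}\mathbb{U}$ denotes the rational Urysohn space: the countable metric space with rational distances, unique up to isometry, such that for every finite subset $A$ and every function $g:A\to\mathbb{Q}$ with $g(a)\ge 0$ and $|g(a)-g(b)|\le d(a,b)\le g(a)+g(b)$ for all $a,b\in A$, there is a point $z$ of the space with $d(z,a)=g(a)$ for all $a\in A$. Isometries of $\mathbb{Q}\mathbb{U}$ are understood to be onto $\mathbb{Q}\mathbb{U}$. *)

theory Defs
  imports "HOL-Analysis.Abstract_Metric_Spaces" "HOL-Algebra.Group_Action"
    "HOL-Algebra.Generated_Groups"
begin

(* The carrier is nonempty: this is the instance A = {} of extension. *)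
locale rational_urysohn_space = Metric_space U d for U :: "'a set" and d +
  assumes countable_carrier: "countable U"
    and rational_distances: "\<And>x y. x \<in> U \<Longrightarrow> y \<in> U \<Longrightarrow> d x y \<in> \<rat>"
    and extension: "\<And>A g. finite A \<Longrightarrow> A \<subseteq> U \<Longrightarrow> (\<And>a. a \<in> A \<Longrightarrow> g a \<in> \<rat>) \<Longrightarrow>
      (\<And>a. a \<in> A \<Longrightarrow> 0 \<le> g a) \<Longrightarrow>
      (\<And>a b. a \<in> A \<Longrightarrow> b \<in> A \<Longrightarrow> \<bar>g a - g b\<bar> \<le> d a b \<and> d a b \<le> g a + g b) \<Longrightarrow>
      \<exists>z\<in>U. \<forall>a\<in>A. d z a = g a"

(* The elements are bijections of U, so isometries are onto; as in BijGroup, they take the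
   value undefined outside U. *)
definition isometry_group :: "'a set \<Rightarrow> ('a \<Rightarrow> 'a \<Rightarrow> real) \<Rightarrow> ('a \<Rightarrow> 'a) monoid"
  where "isometry_group U d =
    (BijGroup U)\<lparr>carrier := {f \<in> Bij U. \<forall>x\<in>U. \<forall>y\<in>U. d (f x) (f y) = d x y}\<rparr>"

end

theory Submission
  imports Defs
begin

text \<open>
  A translation-invariant rational metric on the integers is a length function \<open>F\<close>, through
  \<open>d m n = F (m - n)\<close>. It suffices to find such an \<open>F\<close> with the extension property: by
  back-and-forth the resulting space is isometric to the given one, and the translation by \<open>1\<close>
  generates a transitive group. Now \<open>F\<close> is the limit of length functions of at least linear growth;
  each step keeps the values on a finite window and, given a positive \<open>g\<close> on a finite set \<open>A\<close> satisfying
  the extension inequalities, prescribes the values \<open>g a\<close> at \<open>z - a\<close> for a single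
  \<open>z\<close> far away from the window.
\<close>

subsection \<open>Length functions on the integers\<close>

text \<open>The linear lower bound gives positivity off 0 and finite balls. Its constant may shrink
  from stage to stage; in the limit only positivity is retained.\<close>

definition rational_length :: "(int \<Rightarrow> real) \<Rightarrow> bool"
  where "rational_length f \<longleftrightarrow> f 0 = 0 \<and> (\<forall>n. f n \<in> \<rat>) \<and> (\<forall>n. f (- n) = f n) \<and>
    (\<forall>m n. f (m + n) \<le> f m + f n) \<and> (\<exists>c>0. \<forall>n. c * \<bar>of_int n\<bar> \<le> f n)"

text \<open>The linear lower bound makes the infimum in the following definition attained, which keeps
  the values rational.\<close>
definition word_length :: "(int \<Rightarrow> real) \<Rightarrow> int \<Rightarrow> real"
  where "word_length w n = Inf {sum_list (map w xs) |xs. sum_list xs = n}"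

section \<open>Words over the integers and their cost\<close>

lemma sum_list_weight_ge:
  fixes w :: "int \<Rightarrow> real"
  assumes "0 \<le> c" "\<And>n. c * \<bar>of_int n\<bar> \<le> w n"
  shows "c * \<bar>of_int (sum_list xs)\<bar> \<le> sum_list (map w xs)"
proof (induction xs)
  case (Cons x xs)
  have "c * \<bar>of_int (x + sum_list xs)\<bar> \<le> c * (\<bar>of_int x\<bar> + \<bar>of_int (sum_list xs)\<bar>)"
    using assms(1) by (intro mult_left_mono) auto
  also have "\<dots> \<le> w x + sum_list (map w xs)"
    using Cons assms(2)[of x] by (simp add: distrib_left)
  finally show ?case by simp
qed simp

text \<open>A nonzero integer has absolute value at least 1, so every letter costs at least
  \<open>c\<close>; a cheap word is therefore short.\<close>

lemma sum_list_weight_ge_length: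
  fixes w :: "int \<Rightarrow> real"
  assumes "0 \<le> c" "\<And>n. c * \<bar>of_int n\<bar> \<le> w n" "0 \<notin> set xs"
  shows "c * real (length xs) \<le> sum_list (map w xs)"
  using assms(3)
proof (induction xs)
  case (Cons x xs)
  then have "1 \<le> \<bar>of_int x :: real\<bar>" by (simp flip: of_int_abs) linarith
  then have "c * 1 \<le> c * \<bar>of_int x\<bar>" using assms(1) by (intro mult_left_mono) auto
  then show ?case using Cons assms(2)[of x] by (simp add: algebra_simps)
qed simp

lemma sum_list_weight_filter:
  fixes w :: "int \<Rightarrow> real"
  assumes "w 0 = 0"
  shows "sum_list (map w (filter (\<lambda>x. x \<noteq> 0) xs)) = sum_list (map w xs)"
    and "sum_list (filter (\<lambda>x. x \<noteq> 0) xs) = sum_list xs"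
  using assms by (induction xs) auto

text \<open>A weight has every property of a \<open>rational_length\<close> except subadditivity,
  which passing to the \<open>word_length\<close> supplies.\<close>

locale weight =
  fixes w :: "int \<Rightarrow> real" and c :: real
  assumes c_pos: "0 < c" and w_ge: "\<And>n. c * \<bar>of_int n\<bar> \<le> w n"
    and w_0: "w 0 = 0" and w_minus: "\<And>n. w (- n) = w n" and w_Rats: "\<And>n. w n \<in> \<rat>"
begin

lemma w_nonneg: "0 \<le> w n"
  using w_ge[of n] c_pos by (smt (verit) mult_nonneg_nonneg)

text \<open>Zero letters are free and can be deleted. What remains of a word of cost at most
  \<open>C\<close> has at most \<open>C / c\<close> letters, each of absolute value at most
  \<open>C / c\<close>, so finitely many words account for all these costs.\<close>

lemma finite_bounded_costs: "finite {s. (\<exists>xs. s = sum_list (map w xs) \<and> sum_list xs = n) \<and> s \<le> C}"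
proof -
  define K where "K = nat \<lceil>C / c\<rceil>"
  let ?L = "{xs. set xs \<subseteq> {- int K..int K} \<and> length xs \<le> K}"
  have "{s. (\<exists>xs. s = sum_list (map w xs) \<and> sum_list xs = n) \<and> s \<le> C}
      \<subseteq> (\<lambda>xs. sum_list (map w xs)) ` ?L"
  proof safe
    fix xs
    assume C: "sum_list (map w xs) \<le> C"
    define ys where "ys = filter (\<lambda>x. x \<noteq> 0) xs"
    have ys: "sum_list (map w ys) = sum_list (map w xs)"
      unfolding ys_def using w_0 by (rule sum_list_weight_filter)
    have bound: "k \<le> int K" if "c * of_int k \<le> C" for k
    proof -
      have "of_int k \<le> C / c" using that c_pos by (simp add: field_simps)
      then show ?thesis unfolding K_def by linarith
    qed
    have "c * real (length ys) \<le> C"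
      using sum_list_weight_ge_length[of c w ys] c_pos w_ge ys C by (simp add: ys_def)
    then have "length ys \<le> K" using bound[of "int (length ys)"] by simp
    moreover have "x \<in> {- int K..int K}" if "x \<in> set ys" for x
    proof -
      have "w x \<le> sum_list (map w ys)"
        using that w_nonneg by (intro member_le_sum_list) auto
      then have "c * of_int \<bar>x\<bar> \<le> C" using w_ge[of x] ys C by simp
      then show ?thesis using bound[of "\<bar>x\<bar>"] by auto
    qed
    ultimately show "sum_list (map w xs) \<in> (\<lambda>xs. sum_list (map w xs)) ` ?L"
      using ys[symmetric] by (intro image_eqI[of _ _ ys]) auto
  qed
  then show ?thesis
    by (rule finite_subset) (simp add: finite_lists_length_le)
qed

text \<open>The one-letter word \<open>[n]\<close> competes with cost \<open>w n\<close>, and only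
  finitely many costs are at most \<open>w n\<close>, so the infimum is a minimum.\<close>

lemma word_length_attained:
  "\<exists>xs. sum_list xs = n \<and> word_length w n = sum_list (map w xs)"
  and word_length_le: "word_length w (sum_list ys) \<le> sum_list (map w ys)"
proof -
  have "\<exists>xs. sum_list xs = n \<and> word_length w n = sum_list (map w xs) \<and>
      (\<forall>ys. sum_list ys = n \<longrightarrow> word_length w n \<le> sum_list (map w ys))" for n
  proof -
    let ?S = "{s. (\<exists>xs. s = sum_list (map w xs) \<and> sum_list xs = n) \<and> s \<le> w n}"
    have "w n = sum_list (map w [n])" by simp
    then have "w n \<in> ?S"
      by (metis (mono_tags, lifting) mem_Collect_eq order_refl sum_list.Cons sum_list.Nil add.right_neutral)
    then have M: "Min ?S \<in> ?S" "Min ?S \<le> w n" "\<And>s. s \<in> ?S \<Longrightarrow> Min ?S \<le> s"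
      using finite_bounded_costs[of n "w n"] Min_in[of ?S] by auto
    then have min: "Min ?S \<le> sum_list (map w ys)" if "sum_list ys = n" for ys
      using that by (cases "sum_list (map w ys) \<le> w n") force+
    have "word_length w n = Min ?S"
      unfolding word_length_def using M(1) min by (intro cInf_eq_minimum) auto
    then show ?thesis using M(1) min by auto
  qed
  then show "\<exists>xs. sum_list xs = n \<and> word_length w n = sum_list (map w xs)"
    and "word_length w (sum_list ys) \<le> sum_list (map w ys)"
    by blast+
qed

lemma word_length_le_weight: "word_length w n \<le> w n"
  using word_length_le[of "[n]"] by simp

text \<open>Subadditivity comes from concatenating optimal words, symmetry from negating all
  letters, rationality from attainment; the linear bound passes from letters to words.\<close>

lemma rational_length_word_length: "rational_length (word_length w)"
proof -
  have ge: "c * \<bar>of_int n\<bar> \<le> word_length w n" for n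
    using word_length_attained[of n] sum_list_weight_ge[of c w] c_pos w_ge by (metis less_imp_le)
  have "word_length w 0 = 0"
    using ge[of 0] word_length_le[of "[]"] by simp
  moreover have "word_length w n \<in> \<rat>" for n
  proof -
    have "sum_list (map w xs) \<in> \<rat>" for xs
      by (induction xs) (auto intro: w_Rats Rats_add)
    then show ?thesis using word_length_attained[of n] by metis
  qed
  moreover have "word_length w (m + n) \<le> word_length w m + word_length w n" for m n
  proof -
    obtain xs ys where "sum_list xs = m" "word_length w m = sum_list (map w xs)"
      "sum_list ys = n" "word_length w n = sum_list (map w ys)"
      using word_length_attained by metis
    then show ?thesis using word_length_le[of "xs @ ys"] by simp
  qed
  moreover have "word_length w (- n) = word_length w n" for n
  proof -
    have *: "word_length w (- n) \<le> word_length w n" for n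
    proof -
      obtain xs where xs: "sum_list xs = n" "word_length w n = sum_list (map w xs)"
        using word_length_attained by metis
      have "sum_list (map uminus xs) = - sum_list xs"
        by (induction xs) auto
      then show ?thesis
        using word_length_le[of "map uminus xs"] xs by (simp add: o_def w_minus)
    qed
    show ?thesis using *[of n] *[of "- n"] by simp
  qed
  ultimately show ?thesis unfolding rational_length_def using ge c_pos by blast
qed

end

text \<open>The new length function is the word length of the weight that agrees with \<open>f\<close> except that
  \<open>\<plusminus>(z - a)\<close> costs \<open>g a\<close>. As \<open>f\<close> grows linearly, for \<open>z\<close> large a word that uses the new letters
  in an unintended way leaves a remainder that is too expensive.\<close>
lemma realise_katetov_function:
  assumes f: "rational_length f" and A: "finite A"
    and g_Rats: "\<And>a. a \<in> A \<Longrightarrow> g a \<in> \<rat>" and g_pos: "\<And>a. a \<in> A \<Longrightarrow> 0 < g a"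
    and kat: "\<And>a b. a \<in> A \<Longrightarrow> b \<in> A \<Longrightarrow> \<bar>g a - g b\<bar> \<le> f (a - b) \<and> f (a - b) \<le> g a + g b"
  obtains f' z where "rational_length f'" "\<And>n. \<bar>n\<bar> \<le> N \<Longrightarrow> f' n = f n"
    "\<And>a. a \<in> A \<Longrightarrow> f' (z - a) = g a"
proof -
  obtain c where c: "0 < c" "\<And>n. c * \<bar>of_int n\<bar> \<le> f n"
    using f unfolding rational_length_def by blast
  have f_0: "f 0 = 0" and f_minus: "f (- n) = f n" and f_add: "f (m + n) \<le> f m + f n"
    and f_Rats: "f n \<in> \<rat>" for m n
    using f unfolding rational_length_def by auto
  have "\<exists>M. 0 \<le> M \<and> (\<forall>a\<in>A. \<bar>a\<bar> \<le> M)"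
    using A by (intro exI[of _ "\<Sum>a\<in>A. \<bar>a\<bar>"]) (auto intro: sum_nonneg member_le_sum)
  then obtain M where M: "0 \<le> M" "\<And>a. a \<in> A \<Longrightarrow> \<bar>a\<bar> \<le> M" by blast
  \<comment> \<open>\<open>B\<close> bounds every value that must be protected from shortcuts: the
    prescribed \<open>g\<close> on \<open>A\<close> and the old \<open>f\<close> on the
    window.\<close>
  define B where "B = Max (insert 0 (g ` A \<union> f ` {- N..N}))"
  have B: "0 \<le> B" "\<And>a. a \<in> A \<Longrightarrow> g a \<le> B" "\<And>n. \<bar>n\<bar> \<le> N \<Longrightarrow> f n \<le> B"
    unfolding B_def using A by (auto intro!: Max_ge simp del: Max_insert simp: abs_le_iff)
  define \<delta> where "\<delta> = Min (insert 1 (g ` A))"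
  have \<delta>: "0 < \<delta>" "\<And>a. a \<in> A \<Longrightarrow> \<delta> \<le> g a"
    unfolding \<delta>_def using A g_pos by auto
  define R where "R = max 1 \<lceil>B / c\<rceil>"
  have far: "B \<le> f n" if "R \<le> \<bar>n\<bar>" for n
  proof -
    have "B / c \<le> \<bar>of_int n\<bar>" using that unfolding R_def by linarith
    then show ?thesis using c(1) c(2)[of n] by (simp add: field_simps)
  qed
  \<comment> \<open>Far enough that a block \<open>z - a\<close> exceeds the window by
    \<open>R\<close>, and that two blocks overshoot any target \<open>z - a\<close> by
    \<open>R\<close>: the worst case is \<open>2 * (z - M) - (z + M) = z - 3 * M\<close>.\<close>
  define z where "z = \<bar>N\<bar> + 3 * M + R"
  have R: "1 \<le> R" unfolding R_def by simp
  \<comment> \<open>All \<open>z - a\<close> are positive, so the test says that \<open>n\<close> is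
    plus or minus some \<open>z - a\<close>.\<close>
  define w where "w n = (if z - \<bar>n\<bar> \<in> A then g (z - \<bar>n\<bar>) else f n)" for n
  \<comment> \<open>The new letters are discounts: they lie beyond \<open>R\<close>, where
    \<open>f\<close> is at least \<open>B\<close> and hence at least \<open>g\<close>.\<close>
  have w_le: "w n \<le> f n" for n
  proof (cases "z - \<bar>n\<bar> \<in> A")
    case True
    have "R \<le> \<bar>n\<bar>" using M(1) M(2)[OF True] by (auto simp: z_def)
    then show ?thesis using far[of n] B(2)[OF True] True by (simp add: w_def)
  qed (simp add: w_def)
  \<comment> \<open>A new letter costs at least \<open>\<delta>\<close> and has absolute value at
    most \<open>z + M\<close>; this dictates the second term.\<close>
  define c' where "c' = min c (\<delta> / of_int (z + M))"
  have zM: "0 < z - M" "0 < z + M" using M(1) R by (auto simp: z_def)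
  have c': "0 < c'" using c(1) \<delta>(1) zM(2) by (simp add: c'_def)
  have w_ge: "c' * \<bar>of_int n\<bar> \<le> w n" for n
  proof (cases "z - \<bar>n\<bar> \<in> A")
    case True
    then have "\<bar>n\<bar> \<le> z + M" using M(2)[OF True] by linarith
    then have "\<bar>of_int n\<bar> \<le> (of_int (z + M) :: real)" by linarith
    then have "c' * \<bar>of_int n\<bar> \<le> \<delta> / of_int (z + M) * of_int (z + M)"
      using c' zM(2) \<delta>(1) by (intro mult_mono) (auto simp: c'_def)
    then show ?thesis using True \<delta>(2)[OF True] zM(2) by (simp add: w_def)
  next
    case False
    have "c' * \<bar>of_int n\<bar> \<le> c * \<bar>of_int n\<bar>"
      by (intro mult_right_mono) (auto simp: c'_def)
    then show ?thesis using False c(2)[of n] by (simp add: w_def)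
  qed
  \<comment> \<open>This keeps the letter 0 free: \<open>w 0 = f 0 = 0\<close>.\<close>
  have "z \<notin> A" using M(2)[of z] zM by auto
  then interpret weight w c'
    using c' w_ge f_0 f_minus f_Rats g_Rats by unfold_locales (auto simp: w_def)
  txt \<open>Blocks of opposite sign cancel: \<open>(z - a) - (z - b) = b - a\<close> and
    \<open>f (b - a) \<le> g a + g b\<close>. So a word can be normalised, without raising its cost, to blocks
    \<open>z - a\<close> of a common sign \<open>\<epsilon>\<close> and one remaining letter \<open>m\<close>.\<close>
  define represents where "represents xs as \<epsilon> m \<longleftrightarrow> set as \<subseteq> A \<and> \<bar>\<epsilon>\<bar> = 1 \<and>
      sum_list xs = \<epsilon> * (\<Sum>a\<leftarrow>as. z - a) + m \<and>
      sum_list (map g as) + f m \<le> sum_list (map w xs)" for xs as and \<epsilon> m :: int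
  have rep: "\<exists>as \<epsilon> m. represents xs as \<epsilon> m" for xs
  proof (induction xs)
    case Nil
    have "represents [] [] 1 0" using f_0 by (simp add: represents_def)
    then show ?case by blast
  next
    case (Cons x xs)
    then obtain as \<epsilon> m where IH: "set as \<subseteq> A" "\<bar>\<epsilon>\<bar> = 1"
      "sum_list xs = \<epsilon> * (\<Sum>a\<leftarrow>as. z - a) + m"
      "sum_list (map g as) + f m \<le> sum_list (map w xs)"
      unfolding represents_def by blast
    show ?case
    proof (cases "z - \<bar>x\<bar> \<in> A")
      case False
      then have "represents (x # xs) as \<epsilon> (x + m)"
        using IH f_add[of x m] w_def[of x] by (auto simp: represents_def)
      then show ?thesis by blast
    next
      case True
      define a where "a = z - \<bar>x\<bar>"
      have a: "a \<in> A" "w x = g a" using True by (auto simp: a_def w_def)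
      have "z - a \<ge> 0" by (simp add: a_def)
      obtain \<eta> where \<eta>: "\<bar>\<eta>\<bar> = 1" "x = \<eta> * (z - a)"
      proof (cases "x \<ge> 0")
        case True then show ?thesis using that[of 1] by (simp add: a_def)
      next
        case False then show ?thesis using that[of "- 1"] by (simp add: a_def)
      qed
      show ?thesis
      \<comment> \<open>With no blocks the sign is arbitrary and can be reset to
        \<open>\<eta>\<close>, so both cases simply prepend a block.\<close>
      proof (cases "as = [] \<or> \<eta> = \<epsilon>")
        case True
        then have "x + sum_list xs = \<eta> * (\<Sum>a\<leftarrow>a # as. z - a) + m"
          using IH(3) \<eta>(2) by (auto simp: algebra_simps)
        then have "represents (x # xs) (a # as) \<eta> m"
          using IH(1,4) a \<eta>(1) by (simp add: represents_def)
        then show ?thesis by blast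
      next
        case False
        then obtain b bs where as: "as = b # bs" by (cases as) auto
        have \<eta>\<epsilon>: "\<eta> = - \<epsilon>" using False \<eta>(1) IH(2) by (auto simp: abs_if split: if_splits)
        have b: "b \<in> A" "set bs \<subseteq> A" using IH(1) as by auto
        have "f (\<epsilon> * (a - b)) = f (a - b)"
          using IH(2) f_minus[of "a - b"] by (cases "\<epsilon> = 1") (auto simp: abs_if split: if_splits)
        then have "f (\<epsilon> * (a - b) + m) \<le> g a + g b + f m"
          using kat[OF a(1) b(1)] f_add[of "\<epsilon> * (a - b)" m] by simp
        moreover have "x + sum_list xs = \<epsilon> * (\<Sum>a\<leftarrow>bs. z - a) + (\<epsilon> * (a - b) + m)"
          using IH(3) as \<eta>(2) \<eta>\<epsilon> by (simp add: algebra_simps)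
        ultimately have "represents (x # xs) bs \<epsilon> (\<epsilon> * (a - b) + m)"
          using IH(2,4) as a(2) b(2) by (simp add: represents_def)
        then show ?thesis by blast
      qed
    qed
  qed
  have blocks: "int (length as) * (z - M) \<le> (\<Sum>a\<leftarrow>as. z - a)" if "set as \<subseteq> A" for as
    using that
  proof (induction as)
    case (Cons a as)
    then show ?case using M(2)[of a] by (auto simp: algebra_simps)
  qed simp
  have g_nonneg: "0 \<le> sum_list (map g as)" if "set as \<subseteq> A" for as
    using that g_pos by (intro sum_list_nonneg) (auto intro: less_imp_le)
  have near: "word_length w n = f n" if n: "\<bar>n\<bar> \<le> N" for n
  proof (rule antisym)
    show "word_length w n \<le> f n" using word_length_le_weight w_le by (rule order_trans)
    obtain xs where xs: "sum_list xs = n" "word_length w n = sum_list (map w xs)"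
      using word_length_attained by metis
    obtain as \<epsilon> m where as: "set as \<subseteq> A" "\<bar>\<epsilon>\<bar> = 1" "n = \<epsilon> * (\<Sum>a\<leftarrow>as. z - a) + m"
      "sum_list (map g as) + f m \<le> word_length w n" using rep[of xs] xs unfolding represents_def by metis
    \<comment> \<open>If a block occurs, \<open>m\<close> has to bring the sum back into the window,
      so it lies beyond \<open>R\<close> and \<open>f m\<close> alone costs at least
      \<open>B\<close>.\<close>
    show "f n \<le> word_length w n"
    proof (cases "as = []")
      case True then show ?thesis using as by simp
    next
      case False
      then have "1 * (z - M) \<le> int (length as) * (z - M)"
        using zM by (intro mult_right_mono) (auto simp: Suc_le_eq)
      then have "z - M \<le> (\<Sum>a\<leftarrow>as. z - a)" using blocks[OF as(1)] by simp
      moreover have "\<epsilon> = 1 \<or> \<epsilon> = - 1" using as(2) by linarith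
      ultimately have "R \<le> \<bar>m\<bar>" using as(3) n M(1) by (auto simp: z_def)
      then show ?thesis using far[of m] B(3)[OF n] g_nonneg[OF as(1)] as(4) by linarith
    qed
  qed
  have special: "word_length w (z - a) = g a" if a: "a \<in> A" for a
  proof (rule antisym)
    have "\<bar>z - a\<bar> = z - a" using M(2)[OF a] zM by linarith
    then show "word_length w (z - a) \<le> g a"
      using word_length_le_weight[of "z - a"] a by (simp add: w_def)
    obtain xs where xs: "sum_list xs = z - a" "word_length w (z - a) = sum_list (map w xs)"
      using word_length_attained by metis
    obtain as \<epsilon> m where as: "set as \<subseteq> A" "\<bar>\<epsilon>\<bar> = 1" "z - a = \<epsilon> * (\<Sum>a\<leftarrow>as. z - a) + m"
      "sum_list (map g as) + f m \<le> word_length w (z - a)" using rep[of xs] xs unfolding represents_def by metis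
    have aM: "\<bar>a\<bar> \<le> M" using M(2)[OF a] .
    have \<epsilon>: "\<epsilon> = 1 \<or> \<epsilon> = - 1" using as(2) by linarith
    \<comment> \<open>The intended words have a single positive block \<open>z - b\<close>; then
      \<open>m = b - a\<close>, and \<open>g a - g b \<le> f (b - a)\<close> suffices. All other
      words leave a remainder beyond \<open>R\<close>: several positive blocks overshoot, while no
      block or negative blocks fall short.\<close>
    show "g a \<le> word_length w (z - a)"
    proof (cases "\<epsilon> = 1 \<and> length as = 1")
      case True
      then obtain b where b: "as = [b]" by (auto simp: length_Suc_conv)
      then have "b \<in> A" "m = b - a" using as True by auto
      then show ?thesis using kat[of b a] a b as(4) by auto
    next
      case False
      have "R \<le> \<bar>m\<bar>"
      proof (cases "\<epsilon> = 1 \<and> 2 \<le> length as")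
        case True
        then have "2 * (z - M) \<le> int (length as) * (z - M)"
          using zM by (intro mult_right_mono) auto
        then show ?thesis
          using blocks[OF as(1)] True as(3) aM M(1) by (auto simp: z_def)
      next
        case F: False
        then have "as = [] \<or> \<epsilon> = - 1" using False \<epsilon> by (cases "length as") auto
        moreover have "0 \<le> int (length as) * (z - M)" using zM by simp
        ultimately show ?thesis
          using blocks[OF as(1)] as(3) aM M(1) by (auto simp: z_def)
      qed
      then show ?thesis using far[of m] B(2)[OF a] g_nonneg[OF as(1)] as(4) by linarith
    qed
  qed
  show ?thesis using that rational_length_word_length near special by blast
qed

subsection \<open>A cyclic rational Urysohn space\<close>

text \<open>These are the possible distances to a new point (Katetov functions). Zero values are
  excluded because a point of \<open>A\<close> with value zero already realises
  \<open>g\<close>.\<close>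

definition katetov_on :: "(int \<Rightarrow> real) \<Rightarrow> int set \<Rightarrow> (int \<Rightarrow> real) \<Rightarrow> bool"
  where "katetov_on f A g \<longleftrightarrow> (\<forall>a\<in>A. g a \<in> \<rat> \<and> 0 < g a) \<and>
    (\<forall>a\<in>A. \<forall>b\<in>A. \<bar>g a - g b\<bar> \<le> f (a - b) \<and> f (a - b) \<le> g a + g b)"

text \<open>Pairing each item with a counter makes the enumeration list it infinitely often, so a
  task also comes up at a late stage, when the window covers all differences of its domain.\<close>

lemma ex_large_index:
  fixes l :: "'a :: countable"
  obtains n where "k \<le> n" "fst (from_nat n :: 'a \<times> nat) = l"
proof -
  have "inj (\<lambda>j :: nat. to_nat (l, j))"
    by (rule injI) simp
  then have "infinite (range (\<lambda>j :: nat. to_nat (l, j)))"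
    using finite_imageD infinite_UNIV_nat by blast
  then obtain n where "k \<le> n" "n \<in> range (\<lambda>j :: nat. to_nat (l, j))"
    unfolding infinite_nat_iff_unbounded_le by blast
  then show ?thesis using that by auto
qed

lemma rational_length_abs: "rational_length (\<lambda>n. \<bar>of_int n\<bar>)"
  unfolding rational_length_def by (auto intro!: exI[of _ 1])

lemma realise_katetov_function_window:
  assumes "rational_length f" "finite A"
  shows "\<exists>f' W'. rational_length f' \<and> W \<le> W' \<and> K \<le> W' \<and> (\<forall>k. \<bar>k\<bar> \<le> W \<longrightarrow> f' k = f k) \<and>
    (katetov_on f A g \<longrightarrow> (\<exists>z. \<forall>a\<in>A. \<bar>z - a\<bar> \<le> W' \<and> f' (z - a) = g a))"
proof (cases "katetov_on f A g")
  case True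
  obtain f' z where f': "rational_length f'" "\<And>n. \<bar>n\<bar> \<le> W \<Longrightarrow> f' n = f n"
    "\<And>a. a \<in> A \<Longrightarrow> f' (z - a) = g a"
    using realise_katetov_function[OF assms, of g W] True unfolding katetov_on_def by metis
  have "\<bar>z - a\<bar> \<le> max W (max K (\<Sum>a\<in>A. \<bar>z - a\<bar>))" if "a \<in> A" for a
    using member_le_sum[of a A "\<lambda>a. \<bar>z - a\<bar>"] assms(2) that by simp
  then show ?thesis
    using f' by (intro exI[of _ f'] exI[of _ "max W (max K (\<Sum>a\<in>A. \<bar>z - a\<bar>))"]) auto
next
  case False
  then show ?thesis using assms(1) by (intro exI[of _ f] exI[of _ "max W K"]) auto
qed

text \<open>Finite rational-valued functions form a countable set of tasks. Frozen windows make the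
  values stabilise, so every solution found at some stage survives in the limit.\<close>

lemma ex_cyclic_urysohn_metric:
  obtains F :: "int \<Rightarrow> real" where "rational_urysohn_space UNIV (\<lambda>m n. F (m - n))"
proof -
  define A where "A n = fst ` set (fst (from_nat n :: (int \<times> rat) list \<times> nat))" for n
  \<comment> \<open>The task is an association list; values of \<open>g n\<close> off
    \<open>A n\<close> are arbitrary and never consulted.\<close>
  define g where "g n a = (of_rat (the (map_of (fst (from_nat n :: (int \<times> rat) list \<times> nat)) a)) :: real)"
    for n a
  define Q where "Q n x y \<longleftrightarrow> snd x \<le> snd y \<and> (\<forall>k. \<bar>k\<bar> \<le> snd x \<longrightarrow> fst y k = fst x k) \<and>
      (katetov_on (fst x) (A n) (g n) \<longrightarrow>
        (\<exists>z. \<forall>a\<in>A n. \<bar>z - a\<bar> \<le> snd y \<and> fst y (z - a) = g n a))"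
    for n and x y :: "(int \<Rightarrow> real) \<times> int"
  have "\<exists>s. \<forall>n. (rational_length (fst (s n)) \<and> int n \<le> snd (s n)) \<and> Q n (s n) (s (Suc n))"
  proof (rule dependent_nat_choice)
    show "\<exists>x. rational_length (fst x) \<and> int 0 \<le> snd x"
      using rational_length_abs by (intro exI[of _ "(_, 0)"]) auto
  next
    fix x :: "(int \<Rightarrow> real) \<times> int" and n
    assume x: "rational_length (fst x) \<and> int n \<le> snd x"
    have "finite (A n)" by (simp add: A_def)
    with x obtain f' W' where "rational_length f'" "int (Suc n) \<le> W'" "Q n x (f', W')"
      using realise_katetov_function_window[of "fst x" "A n" "snd x" "int (Suc n)" "g n"]
      unfolding Q_def by auto
    then show "\<exists>y. (rational_length (fst y) \<and> int (Suc n) \<le> snd y) \<and> Q n x y"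
      by (intro exI[of _ "(f', W')"]) auto
  qed
  then obtain s where s: "\<And>n. rational_length (fst (s n))" "\<And>n. int n \<le> snd (s n)"
    "\<And>n. Q n (s n) (s (Suc n))" by blast
  define f W where "f n = fst (s n)" and "W n = snd (s n)" for n
  have f: "rational_length (f n)" and W: "int n \<le> W n" for n
    using s by (auto simp: f_def W_def)
  have W_Suc: "W n \<le> W (Suc n)" and f_Suc: "\<And>k. \<bar>k\<bar> \<le> W n \<Longrightarrow> f (Suc n) k = f n k"
    and task: "katetov_on (f n) (A n) (g n) \<Longrightarrow>
      \<exists>z. \<forall>a\<in>A n. \<bar>z - a\<bar> \<le> W (Suc n) \<and> f (Suc n) (z - a) = g n a" for n
    using s(3)[of n] unfolding Q_def f_def W_def by auto
  have W_mono: "W m \<le> W n" if "m \<le> n" for m n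
    using that W_Suc by (rule lift_Suc_mono_le[rotated])
  have f_stable: "f n k = f m k" if "m \<le> n" "\<bar>k\<bar> \<le> W m" for m n k
    using that(1)
  proof (induction n rule: dec_induct)
    case (step n)
    then show ?case using f_Suc[of k n] W_mono[of m n] that(2) by simp
  qed simp
  \<comment> \<open>Stage \<open>\<bar>k\<bar>\<close> is late enough since
    \<open>n \<le> W n\<close>; every stage whose window contains \<open>k\<close> gives the same
    value.\<close>
  define F where "F k = f (nat \<bar>k\<bar>) k" for k
  have F: "F k = f n k" if "\<bar>k\<bar> \<le> W n" for n k
    using f_stable[of n "nat \<bar>k\<bar>" k] f_stable[of "nat \<bar>k\<bar>" n k] W[of "nat \<bar>k\<bar>"] that
    unfolding F_def by (cases "n \<le> nat \<bar>k\<bar>") auto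
  have F_0: "F 0 = 0" and F_Rats: "F k \<in> \<rat>" for k
    using f unfolding F_def rational_length_def by auto
  have F_pos: "0 < F k" if "k \<noteq> 0" for k
  proof -
    obtain c where "0 < c" "c * \<bar>of_int k\<bar> \<le> F k"
      using f[of "nat \<bar>k\<bar>"] unfolding F_def rational_length_def by blast
    then show ?thesis using that by (smt (verit) mult_pos_pos of_int_eq_0_iff zero_less_abs_iff)
  qed
  have F_minus: "F (- k) = F k" for k
    using f[of "nat \<bar>k\<bar>"] unfolding F_def rational_length_def by simp
  have F_add: "F (k + l) \<le> F k + F l" for k l
  proof -
    define n where "n = nat (\<bar>k\<bar> + \<bar>l\<bar>)"
    have "F (k + l) = f n (k + l)" "F k = f n k" "F l = f n l"
      using W[of n] by (auto intro!: F simp: n_def)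
    then show ?thesis using f[of n] unfolding rational_length_def by simp
  qed
  have "rational_urysohn_space UNIV (\<lambda>m n. F (m - n))"
  proof unfold_locales
    fix B :: "int set" and h :: "int \<Rightarrow> real"
    assume B: "finite B" and h: "\<And>a. a \<in> B \<Longrightarrow> h a \<in> \<rat>" "\<And>a. a \<in> B \<Longrightarrow> 0 \<le> h a"
      "\<And>a b. a \<in> B \<Longrightarrow> b \<in> B \<Longrightarrow> \<bar>h a - h b\<bar> \<le> F (a - b) \<and> F (a - b) \<le> h a + h b"
    show "\<exists>z\<in>UNIV. \<forall>a\<in>B. F (z - a) = h a"
    \<comment> \<open>A zero value at \<open>a\<close> forces \<open>h b = F (a - b)\<close> for all
      \<open>b\<close>, so \<open>a\<close> itself is the point sought.\<close>
    proof (cases "\<exists>a\<in>B. h a = 0")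
      case True
      then obtain a where "a \<in> B" "h a = 0" by blast
      moreover have "F (a - b) = h b" if "b \<in> B" for b
        using h(3)[OF \<open>a \<in> B\<close> that] h(2)[OF that] \<open>h a = 0\<close> by linarith
      ultimately show ?thesis by blast
    next
      case False
      have "\<forall>a\<in>B. \<exists>q. h a = of_rat q"
        using h(1) by (auto elim: Rats_cases)
      then obtain q where q: "\<And>a. a \<in> B \<Longrightarrow> h a = of_rat (q a)"
        using bchoice by metis
      define l where "l = map (\<lambda>a. (a, q a)) (sorted_list_of_set B)"
      \<comment> \<open>This bounds all differences within \<open>B\<close>, so from stage
        \<open>k\<close> on \<open>F\<close> agrees with \<open>f n\<close> there and
        \<open>h\<close> is Katetov for \<open>f n\<close>.\<close>
      define k where "k = nat (\<Sum>a\<in>B. \<Sum>b\<in>B. \<bar>a - b\<bar>)"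
      obtain n where n: "k \<le> n" "fst (from_nat n :: (int \<times> rat) list \<times> nat) = l"
        using ex_large_index by blast
      have A: "A n = B" using B by (force simp: A_def n l_def)
      have g: "g n a = h a" if "a \<in> B" for a
        using that B q by (simp add: g_def n l_def map_of_map_restrict)
      have "F (a - b) = f n (a - b)" if "a \<in> B" "b \<in> B" for a b
      proof (rule F)
        have "\<bar>a - b\<bar> \<le> (\<Sum>b\<in>B. \<bar>a - b\<bar>)"
          using that B by (intro member_le_sum) auto
        also have "\<dots> \<le> (\<Sum>a\<in>B. \<Sum>b\<in>B. \<bar>a - b\<bar>)"
          using that B by (intro member_le_sum[of a B "\<lambda>a. \<Sum>b\<in>B. \<bar>a - b\<bar>"]) (auto intro: sum_nonneg)
        also have "\<dots> \<le> W n" using n(1) W[of n] unfolding k_def by linarith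
        finally show "\<bar>a - b\<bar> \<le> W n" .
      qed
      then have "katetov_on (f n) (A n) (g n)"
        using h False unfolding katetov_on_def A by (simp add: g less_le)
      then obtain z where "\<forall>a\<in>B. \<bar>z - a\<bar> \<le> W (Suc n) \<and> f (Suc n) (z - a) = g n a"
        using task A by blast
      then show ?thesis using g F by (intro bexI[of _ z]) auto
    qed
  next
    show "0 \<le> F (m - n)" for m n
      using F_0 F_pos[of "m - n"] by (cases "m = n") auto
    show "F (m - n) = F (n - m)" for m n
      using F_minus[of "m - n"] by simp
    show "F (m - n) = 0 \<longleftrightarrow> m = n" for m n
      using F_0 F_pos[of "m - n"] by fastforce
    show "F (m - k) \<le> F (m - n) + F (n - k)" for m n k
      using F_add[of "m - n" "n - k"] by simp
  qed (auto intro: F_Rats)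
  then show ?thesis by (rule that)
qed

subsection \<open>Uniqueness of the rational Urysohn space\<close>

text \<open>A relation rather than a function, so that the back step is the forth step for the
  converse.\<close>

definition partial_isometry ::
    "'a set \<Rightarrow> ('a \<Rightarrow> 'a \<Rightarrow> real) \<Rightarrow> 'b set \<Rightarrow> ('b \<Rightarrow> 'b \<Rightarrow> real) \<Rightarrow> ('a \<times> 'b) set \<Rightarrow> bool"
  where "partial_isometry U d V e R \<longleftrightarrow> finite R \<and> R \<subseteq> U \<times> V \<and>
    (\<forall>(x, y)\<in>R. \<forall>(x', y')\<in>R. d x x' = e y y')"

lemma partial_isometry_converse:
  "partial_isometry U d V e R \<Longrightarrow> partial_isometry V e U d (R\<inverse>)"
  unfolding partial_isometry_def by (fastforce simp: split_def)

lemma converse_insert: "(insert (x, y) R)\<inverse> = insert (y, x) (R\<inverse>)"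
  by auto

text \<open>The distances from \<open>x\<close> to the domain of \<open>R\<close>, carried to its
  range, satisfy the extension inequalities by the triangle inequality in \<open>U\<close>; a point
  of \<open>V\<close> realising them is the image of \<open>x\<close>.\<close>

lemma partial_isometry_extend:
  assumes "rational_urysohn_space U d" "rational_urysohn_space V e"
    and R: "partial_isometry U d V e R" and x: "x \<in> U"
  obtains y where "y \<in> V" "partial_isometry U d V e (insert (x, y) R)"
proof -
  interpret U: rational_urysohn_space U d by fact
  interpret V: rational_urysohn_space V e by fact
  have fin: "finite R" and sub: "R \<subseteq> U \<times> V"
    and iso: "\<And>a b a' b'. (a, b) \<in> R \<Longrightarrow> (a', b') \<in> R \<Longrightarrow> d a a' = e b b'"
    using R unfolding partial_isometry_def by auto
  \<comment> \<open>\<open>h\<close> inverts \<open>R\<close>; the choice is forced, because points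
    at distance zero coincide.\<close>
  define h where "h b = (SOME a. (a, b) \<in> R)" for b
  have h: "(h b, b) \<in> R" if "b \<in> snd ` R" for b
    using that unfolding h_def by (auto intro: someI)
  have hU: "h b \<in> U" if "b \<in> snd ` R" for b
    using h[OF that] sub by auto
  have h_eq: "h b = a" if "(a, b) \<in> R" for a b
  proof -
    have "(h b, b) \<in> R" using that by (intro h) force
    then have "d (h b) a = e b b" "h b \<in> U" "a \<in> U" "b \<in> V" using that iso sub by auto
    then show ?thesis by simp
  qed
  have "\<exists>y\<in>V. \<forall>b\<in>snd ` R. e y b = d x (h b)"
  proof (rule V.extension)
    fix a b assume ab: "a \<in> snd ` R" "b \<in> snd ` R"
    have e: "e a b = d (h a) (h b)" using iso h ab by metis
    show "\<bar>d x (h a) - d x (h b)\<bar> \<le> e a b \<and> e a b \<le> d x (h a) + d x (h b)"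
      unfolding e
      using U.triangle[OF x hU[OF ab(1)] hU[OF ab(2)]] U.triangle[OF x hU[OF ab(2)] hU[OF ab(1)]]
        U.triangle[OF hU[OF ab(1)] x hU[OF ab(2)]] U.commute[of x "h a"] U.commute[of "h a" "h b"]
      by linarith
  qed (use fin sub hU x U.rational_distances in auto)
  then obtain y where y: "y \<in> V" "\<And>b. b \<in> snd ` R \<Longrightarrow> e y b = d x (h b)" by blast
  have new: "d x a = e y b" "d a x = e b y" if "(a, b) \<in> R" for a b
    using y(2)[of b] h_eq[OF that] that U.commute[of a x] V.commute[of b y] by force+
  have "d a a' = e b b'" if "(a, b) \<in> insert (x, y) R" "(a', b') \<in> insert (x, y) R" for a a' b b'
    using that x y(1) by (auto intro: new iso)
  then have "partial_isometry U d V e (insert (x, y) R)"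
    unfolding partial_isometry_def using fin sub x y(1) by blast
  then show ?thesis using that y(1) by blast
qed

text \<open>Back-and-forth: stage \<open>n\<close> puts the \<open>n\<close>-th point of
  \<open>U\<close> into the domain and the \<open>n\<close>-th point of \<open>V\<close> into the
  range, and the union of the stages is the graph of an isometry onto \<open>V\<close>.\<close>

lemma rational_urysohn_space_unique:
  assumes U: "rational_urysohn_space U d" and V: "rational_urysohn_space V e"
  obtains \<phi> where "bij_betw \<phi> U V" "\<And>x y. x \<in> U \<Longrightarrow> y \<in> U \<Longrightarrow> e (\<phi> x) (\<phi> y) = d x y"
proof -
  interpret U: rational_urysohn_space U d by fact
  interpret V: rational_urysohn_space V e by fact
  have ne: "U \<noteq> {}" "V \<noteq> {}"
    using U.extension[of "{}" "\<lambda>_. 0"] V.extension[of "{}" "\<lambda>_. 0"] by auto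
  have "\<exists>S. \<forall>n. partial_isometry U d V e (S n) \<and>
      (S n \<subseteq> S (Suc n) \<and> from_nat_into U n \<in> fst ` S (Suc n) \<and> from_nat_into V n \<in> snd ` S (Suc n))"
  proof (rule dependent_nat_choice)
    show "\<exists>R. partial_isometry U d V e R"
      by (intro exI[of _ "{}"]) (simp add: partial_isometry_def)
  next
    fix R n assume R: "partial_isometry U d V e R"
    obtain y where y: "partial_isometry U d V e (insert (from_nat_into U n, y) R)"
      using partial_isometry_extend[OF U V R from_nat_into[OF ne(1)]] by blast
    obtain x where "partial_isometry V e U d
        (insert (from_nat_into V n, x) ((insert (from_nat_into U n, y) R)\<inverse>))"
      using partial_isometry_extend[OF V U partial_isometry_converse[OF y] from_nat_into[OF ne(2)]]
      by blast
    from partial_isometry_converse[OF this]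
    have "partial_isometry U d V e
        (insert (x, from_nat_into V n) (insert (from_nat_into U n, y) R))"
      by (simp add: converse_insert)
    then show "\<exists>R'. partial_isometry U d V e R' \<and>
        (R \<subseteq> R' \<and> from_nat_into U n \<in> fst ` R' \<and> from_nat_into V n \<in> snd ` R')"
      by (intro exI conjI) auto
  qed
  then obtain S where S: "\<And>n. partial_isometry U d V e (S n)" "\<And>n. S n \<subseteq> S (Suc n)"
    "\<And>n. from_nat_into U n \<in> fst ` S (Suc n)" "\<And>n. from_nat_into V n \<in> snd ` S (Suc n)"
    by blast
  define G where "G = (\<Union>n. S n)"
  have mono: "S m \<subseteq> S n" if "m \<le> n" for m n
    using that S(2) by (rule lift_Suc_mono_le[rotated])
  have GU: "G \<subseteq> U \<times> V" using S(1) unfolding partial_isometry_def G_def by blast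
  have iso: "d a a' = e b b'" if ab: "(a, b) \<in> G" "(a', b') \<in> G" for a b a' b'
  proof -
    obtain m n where "(a, b) \<in> S m" "(a', b') \<in> S n" using ab unfolding G_def by blast
    then have "(a, b) \<in> S (max m n)" "(a', b') \<in> S (max m n)"
      using mono[of m "max m n"] mono[of n "max m n"] by auto
    then show ?thesis using S(1)[of "max m n"] unfolding partial_isometry_def by blast
  qed
  have dom: "\<exists>y. (x, y) \<in> G" if x: "x \<in> U" for x
  proof -
    obtain n where "x = from_nat_into U n"
      using from_nat_into_surj[OF U.countable_carrier x] by metis
    then show ?thesis using S(3)[of n] unfolding G_def by force
  qed
  have ran: "\<exists>x. (x, y) \<in> G" if y: "y \<in> V" for y
  proof -
    obtain n where "y = from_nat_into V n"
      using from_nat_into_surj[OF V.countable_carrier y] by metis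
    then show ?thesis using S(4)[of n] unfolding G_def by force
  qed
  define \<phi> where "\<phi> x = (SOME y. (x, y) \<in> G)" for x
  have \<phi>: "(x, \<phi> x) \<in> G" if "x \<in> U" for x
    using dom[OF that] unfolding \<phi>_def by (rule someI_ex)
  have isom: "e (\<phi> x) (\<phi> y) = d x y" if "x \<in> U" "y \<in> U" for x y
    using iso[OF \<phi>[OF that(1)] \<phi>[OF that(2)]] by simp
  have \<phi>V: "\<phi> x \<in> V" if "x \<in> U" for x using \<phi>[OF that] GU by auto
  have "bij_betw \<phi> U V"
    unfolding bij_betw_def
  proof
    show "inj_on \<phi> U"
      using isom \<phi>V by (metis U.zero V.zero inj_onI)
    show "\<phi> ` U = V"
    proof safe
      fix y assume "y \<in> V"
      then obtain x where x: "(x, y) \<in> G" using ran by blast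
      then have xU: "x \<in> U" using GU by auto
      have "e (\<phi> x) y = 0" using iso[OF \<phi>[OF xU] x] xU by simp
      then have "\<phi> x = y" using \<phi>V[OF xU] \<open>y \<in> V\<close> by simp
      then show "y \<in> \<phi> ` U" using xU by blast
    qed (rule \<phi>V)
  qed
  then show ?thesis using that isom by blast
qed

subsection \<open>Transitivity of the translations\<close>

lemma subgroup_isometries:
  "subgroup {f \<in> Bij U. \<forall>x\<in>U. \<forall>y\<in>U. d (f x) (f y) = d x y} (BijGroup U)"
    (is "subgroup ?I _")
proof
  show "?I \<subseteq> carrier (BijGroup U)" by (auto simp: BijGroup_def)
  show "\<one>\<^bsub>BijGroup U\<^esub> \<in> ?I" using id_Bij[of U] by (simp add: BijGroup_def)
  show "f \<otimes>\<^bsub>BijGroup U\<^esub> g \<in> ?I" if "f \<in> ?I" "g \<in> ?I" for f g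
    using that Bij_imp_funcset[of g U] compose_Bij[of f U g]
    by (auto simp: BijGroup_def compose_def Pi_iff)
  show "inv\<^bsub>BijGroup U\<^esub> f \<in> ?I" if "f \<in> ?I" for f
  proof -
    have "f ` U = U" using that by (auto simp: Bij_def bij_betw_def)
    then have "f (inv_into U f x) = x" "inv_into U f x \<in> U" if "x \<in> U" for x
      using that by (auto simp: f_inv_into_f inv_into_into)
    then have "d (inv_into U f x) (inv_into U f y) = d x y" if "x \<in> U" "y \<in> U" for x y
      using that \<open>f \<in> ?I\<close> by (smt (verit) mem_Collect_eq)
    then show ?thesis using that by (simp add: inv_BijGroup restrict_inv_into_Bij)
  qed
qed

lemma group_isometry_group: "group (isometry_group U d)"
  unfolding isometry_group_def
  by (rule subgroup.subgroup_is_group[OF subgroup_isometries group_BijGroup])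

text \<open>The elements are already bijections of \<open>U\<close>, multiplied as in
  \<open>BijGroup U\<close>, so the action is the inclusion homomorphism.\<close>

lemma group_action_subgroup_generated_isometries:
  "group_action (subgroup_generated (isometry_group U d) S) U (\<lambda>h. h)"
proof -
  interpret G: group "isometry_group U d" by (rule group_isometry_group)
  have "carrier (subgroup_generated (isometry_group U d) S) \<subseteq> carrier (BijGroup U)"
    using G.carrier_subgroup_generated_subset[of S]
    by (auto simp: isometry_group_def BijGroup_def)
  moreover have "mult (subgroup_generated (isometry_group U d) S) = mult (BijGroup U)"
    by (simp add: subgroup_generated_def isometry_group_def)
  ultimately have "(\<lambda>h. h) \<in> hom (subgroup_generated (isometry_group U d) S) (BijGroup U)"
    by (auto simp: hom_def)
  then show ?thesis
    by (intro group_action.intro group_hom.intro group_hom_axioms.intro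
        G.group_subgroup_generated group_BijGroup)
qed

theorem theorem6:
  fixes U :: "'a set" and d :: "'a \<Rightarrow> 'a \<Rightarrow> real"
  assumes "rational_urysohn_space U d"
  shows "\<exists>g \<in> carrier (isometry_group U d).
    transitive_action (subgroup_generated (isometry_group U d) {g}) U (\<lambda>h. h)"
proof -
  obtain F :: "int \<Rightarrow> real" where F: "rational_urysohn_space UNIV (\<lambda>m n. F (m - n))"
    by (rule ex_cyclic_urysohn_metric)
  obtain \<phi> where \<phi>: "bij_betw \<phi> (UNIV :: int set) U" and iso: "\<And>m n. d (\<phi> m) (\<phi> n) = F (m - n)"
    using rational_urysohn_space_unique[OF F assms] by (metis UNIV_I)
  define \<psi> where "\<psi> = inv_into UNIV \<phi>"
  have \<psi>\<phi>: "\<psi> (\<phi> n) = n" for n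
    using \<phi> by (simp add: \<psi>_def bij_betw_def)
  have \<phi>\<psi>: "\<phi> (\<psi> x) = x" if "x \<in> U" for x
    using \<phi> that by (auto simp: \<psi>_def bij_betw_def f_inv_into_f)
  have \<phi>U: "\<phi> n \<in> U" for n
    using \<phi> by (auto simp: bij_betw_def)
  \<comment> \<open>Translation by \<open>k\<close>, carried to \<open>U\<close> along
    \<open>\<phi>\<close>; the restriction makes it \<open>undefined\<close> outside
    \<open>U\<close>, as \<open>Bij\<close> demands.\<close>
  define t where "t k = (\<lambda>x\<in>U. \<phi> (\<psi> x + k))" for k
  interpret G: group "isometry_group U d" by (rule group_isometry_group)
  have "bij_betw (t k) U U" for k
    by (rule bij_betw_byWitness[where f' = "t (- k)"]) (auto simp: t_def \<phi>U \<psi>\<phi> \<phi>\<psi>)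
  then have Bij: "t k \<in> Bij U" for k
    by (simp add: Bij_def t_def)
  \<comment> \<open>\<open>F\<close> sees only the difference of two integers, which a translation
    preserves.\<close>
  then have t: "t k \<in> carrier (isometry_group U d)" for k
    using iso \<phi>\<psi> by (auto simp: isometry_group_def t_def) (metis add_diff_cancel_right)+
  have t_add: "t k \<otimes>\<^bsub>isometry_group U d\<^esub> t l = t (k + l)" for k l
    using Bij by (auto simp: isometry_group_def BijGroup_def compose_def t_def fun_eq_iff \<phi>U \<psi>\<phi> ac_simps)
  have t_0: "t 0 = \<one>\<^bsub>isometry_group U d\<^esub>"
    by (auto simp: isometry_group_def BijGroup_def t_def fun_eq_iff \<phi>\<psi>)
  have inv_t: "inv\<^bsub>isometry_group U d\<^esub> (t 1) = t (- 1)"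
    by (rule G.inv_equality) (auto simp: t t_add t_0)
  \<comment> \<open>Going up multiplies by \<open>t 1\<close>, going down by its inverse
    \<open>t (- 1)\<close>.\<close>
  have gen: "t k \<in> generate (isometry_group U d) {t 1}" for k
  proof (induction k rule: int_induct[of _ 0])
    case base
    show ?case using generate.one[of "isometry_group U d"] by (simp add: t_0)
  next
    case (step1 k)
    then show ?case
      using generate.eng[OF step1(2) generate.incl[of "t 1"]] by (simp add: t_add)
  next
    case (step2 k)
    then show ?case
      using generate.eng[OF step2(2) generate.inv[of "t 1"]] by (simp add: t_add inv_t)
  qed
  have "transitive_action (subgroup_generated (isometry_group U d) {t 1}) U (\<lambda>h. h)"
  proof (intro transitive_action.intro group_action_subgroup_generated_isometries
      transitive_action_axioms.intro)
    fix x y assume "x \<in> U" "y \<in> U"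
    then have "t (\<psi> y - \<psi> x) x = y" by (simp add: t_def \<phi>\<psi>)
    then show "\<exists>h\<in>carrier (subgroup_generated (isometry_group U d) {t 1}). h x = y"
      using gen t by (auto simp: carrier_subgroup_generated)
  qed
  then show ?thesis using t by blast
qed

end
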